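(* Let $n\ge1$, let $\rho=\operatorname{diag}(\rho_1,\dots,\rho_n)$ with $\rho_s>0$ and $\sum_s\rho_s=1$, and let $\Delta=(\Delta_{st})_{s,t\le n}$ be a noise profile: a symmetric matrix with entries in $(0,\infty)$ such that $\frac1\Delta=(1/\Delta_{st})_{s,t}$ is positive semidefinite. Let $\frac{1}{\Delta^{\odot1/2}}=(\Delta_{st}^{-1/2})_{s,t}$. Then $$\Big\|\sqrt\rho\,\frac{1}{\Delta^{\odot\frac12}}\sqrt\rho\Big\|_{op}^2\le\Big\|\sqrt\rho\,\frac1\Delta\sqrt\rho\Big\|_{op},$$ with equality if and only if there is a constant $c$ such that $\Delta_{st}=c$ for all $s,t$. In particular, if $x$ is an $\mathbb R^\kappa$-valued random vector with law $P_0$ of compact support and $\operatorname{Cov}(x)\neq0$, then, among noise profiles $\Delta$ that are not constant ($n\ge2$), $$\Big\{\Delta:\Big\|\sqrt\rho\,\frac{1}{\Delta^{\odot\frac12}}\sqrt\rho\Big\|_{op}\ge\frac{1}{\|\operatorname{Cov}(x)\|_{op}}\Big\}\subset\Big\{\Delta:\Big\|\sqrt\rho\,\frac1\Delta\sqrt\rho\Big\|_{op}\ge\frac1{\|\operatorname{Cov}(x)\|_{op}^2}\Big\},$$ and the containment is strict.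
   Context: $\|\cdot\|_{op}$ denotes the operator norm; $\odot$ denotes entrywise (Hadamard) operations, and $\frac1\Delta$ denotes the entrywise inverse. *)

theory Defs
  imports "HOL-Analysis.Analysis" "HOL-Probability.Probability"
begin

text \<open>The norm on \<^typ>\<open>real ^ 'n\<close> is Euclidean, so this is the spectral norm.\<close>

definition op_norm :: "real ^ 'n ^ 'm \<Rightarrow> real" where
  "op_norm A = onorm (\<lambda>v. A *v v)"

definition diag_matrix :: "real ^ 'n \<Rightarrow> real ^ 'n ^ 'n" where
  "diag_matrix r = (\<chi> s t. if s = t then r $ s else 0)"

text \<open>For \<open>\<rho> = diag_matrix r\<close> with \<open>r\<close> nonnegative, this is the matrix square root of \<open>\<rho>\<close>.\<close>

definition sqrt_diag :: "real ^ 'n \<Rightarrow> real ^ 'n ^ 'n" where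
  "sqrt_diag r = diag_matrix (\<chi> s. sqrt (r $ s))"

definition hadamard_inverse :: "real ^ 'n ^ 'm \<Rightarrow> real ^ 'n ^ 'm" where
  "hadamard_inverse A = (\<chi> s t. 1 / A $ s $ t)"

definition hadamard_sqrt :: "real ^ 'n ^ 'm \<Rightarrow> real ^ 'n ^ 'm" where
  "hadamard_sqrt A = (\<chi> s t. sqrt (A $ s $ t))"

definition pos_semidef :: "real ^ 'n ^ 'n \<Rightarrow> bool" where
  "pos_semidef A \<longleftrightarrow> transpose A = A \<and> (\<forall>v. 0 \<le> v \<bullet> (A *v v))"

definition noise_profile :: "real ^ 'n ^ 'n \<Rightarrow> bool" where
  "noise_profile \<Delta> \<longleftrightarrow>
     transpose \<Delta> = \<Delta> \<and> (\<forall>s t. 0 < \<Delta> $ s $ t) \<and> pos_semidef (hadamard_inverse \<Delta>)"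

definition constant_profile :: "real ^ 'n ^ 'n \<Rightarrow> bool" where
  "constant_profile \<Delta> \<longleftrightarrow> (\<exists>c. \<forall>s t. \<Delta> $ s $ t = c)"

definition measure_support :: "'a::topological_space measure \<Rightarrow> 'a set" where
  "measure_support P = {x. \<forall>U. open U \<longrightarrow> x \<in> U \<longrightarrow> 0 < emeasure P U}"

definition covariance_matrix :: "'a measure \<Rightarrow> ('a \<Rightarrow> real ^ 'k) \<Rightarrow> real ^ 'k ^ 'k" where
  "covariance_matrix M x =
     (\<chi> i j. \<integral>\<omega>. (x \<omega> $ i - (\<integral>\<omega>'. x \<omega>' $ i \<partial>M)) * (x \<omega> $ j - (\<integral>\<omega>'. x \<omega>' $ j \<partial>M)) \<partial>M)"

end

theory Submission
  imports Defs
begin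

text \<open>
  Let \<open>u\<close> be the unit vector with entries \<open>sqrt (\<rho>\<^sub>s)\<close> and \<open>A\<close> the entrywise inverse square root of
  \<open>\<Delta>\<close>. As \<open>A\<close> is positive, the norm \<open>S\<close> of \<open>sqrt \<rho> A sqrt \<rho>\<close> is attained as a bilinear form at
  nonnegative unit vectors \<open>w\<close>, \<open>v\<close>, so that \<open>S\<close> is the sum of \<open>p\<^sub>s\<^sub>t A\<^sub>s\<^sub>t\<close> with weights
  \<open>p\<^sub>s\<^sub>t = u\<^sub>s w\<^sub>s u\<^sub>t v\<^sub>t\<close> of total mass \<open>(u \<bullet> w) (u \<bullet> v) \<le> 1\<close>. Expanding the
  nonnegative sum of \<open>p\<^sub>s\<^sub>t (A\<^sub>s\<^sub>t - S)\<^sup>2\<close> gives the inequality; equality forces \<open>w = v = u\<close>, hence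
  positive weights, hence \<open>A\<close> constant.
  The inclusion follows at once. It is strict because a nonconstant profile can be rescaled until
  the larger norm equals the threshold, and then the strict inequality excludes it from the
  smaller set.
\<close>

section \<open>Operator norm: attainment, positivity, scaling\<close>

lemma norm_matrix_vector_mult_le:
  fixes A :: "real ^ 'n ^ 'm"
  shows "norm (A *v v) \<le> op_norm A * norm v"
  unfolding op_norm_def by (rule onorm[OF matrix_vector_mul_bounded_linear])

lemma inner_le_op_norm:
  fixes A :: "real ^ 'n ^ 'm"
  assumes "norm w = 1" "norm v = 1"
  shows "w \<bullet> (A *v v) \<le> op_norm A"
  using norm_cauchy_schwarz[of w "A *v v"] norm_matrix_vector_mult_le[of A v] assms by simp

text \<open>Compactness of the unit sphere yields a maximiser \<open>v\<close> of the length of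
  \<open>A *v v\<close>; the matching \<open>w\<close> is the normalised image
  \<open>A *v v\<close>.\<close>

lemma op_norm_attained:
  fixes A :: "real ^ 'n ^ 'm"
  obtains w v where "norm w = 1" "norm v = 1" "op_norm A = w \<bullet> (A *v v)"
proof -
  have "continuous_on (sphere 0 1) (\<lambda>v. norm (A *v v))"
    by (intro continuous_intros linear_continuous_on matrix_vector_mul_bounded_linear)
  moreover have "axis undefined 1 \<in> sphere (0 :: real ^ 'n) 1"
    by simp
  ultimately obtain v :: "real ^ 'n" where v: "norm v = 1"
    and max: "\<And>y. norm y = 1 \<Longrightarrow> norm (A *v y) \<le> norm (A *v v)"
    using continuous_attains_sup[of "sphere (0 :: real ^ 'n) 1" "\<lambda>v. norm (A *v v)"]
    by (metis compact_sphere dist_0_norm empty_iff mem_sphere)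
  have "norm (A *v y) \<le> norm (A *v v) * norm y" for y
  proof (cases "y = 0")
    case False
    then have "norm (A *v ((1 / norm y) *\<^sub>R y)) \<le> norm (A *v v)"
      by (intro max) simp
    then show ?thesis
      using False by (simp add: matrix_vector_mult_scaleR field_simps)
  qed simp
  then have "op_norm A \<le> norm (A *v v)"
    unfolding op_norm_def by (rule onorm_le)
  then have eq: "op_norm A = norm (A *v v)"
    using norm_matrix_vector_mult_le[of A v] v by simp
  show thesis
  \<comment> \<open>A zero image cannot be normalised, but then the norm is 0 and any unit vector
    serves as \<open>w\<close>.\<close>
  proof (cases "A *v v = 0")
    case True
    then show thesis
      using that[of "axis undefined 1" v] v eq by simp
  next
    case False
    then show thesis
      using that[of "(1 / norm (A *v v)) *\<^sub>R (A *v v)" v] v eq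
      by (simp add: power2_norm_eq_inner[symmetric] power2_eq_square)
  qed
qed

lemma op_norm_pos:
  fixes A :: "real ^ 'n ^ 'm"
  assumes "A \<noteq> 0"
  shows "0 < op_norm A"
proof -
  have "\<not> (\<forall>v. A *v v = 0)"
    using assms by (metis matrix_eq matrix_vector_mult_0)
  then show ?thesis
    unfolding op_norm_def by (simp add: onorm_pos_lt)
qed

lemma op_norm_scaleR: "op_norm (k *\<^sub>R (A :: real ^ 'n ^ 'm)) = \<bar>k\<bar> * op_norm A"
  unfolding op_norm_def scaleR_matrix_vector_assoc[symmetric]
  by (rule onorm_scaleR[OF matrix_vector_mul_bounded_linear])

lemma norm_abs_vec: "norm (\<chi> i. \<bar>v $ i\<bar>) = norm (v :: real ^ 'n)"
  by (simp add: norm_vec_def)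

section \<open>The weighted matrix and its bilinear form\<close>

definition sqrt_vec :: "real ^ 'n \<Rightarrow> real ^ 'n" where
  "sqrt_vec r = (\<chi> s. sqrt (r $ s))"

definition sandwich :: "real ^ 'n \<Rightarrow> real ^ 'n ^ 'n \<Rightarrow> real ^ 'n ^ 'n" where
  "sandwich r X = sqrt_diag r ** X ** sqrt_diag r"

lemma sandwich_nth:
  "sandwich r X $ s $ t = sqrt_vec r $ s * X $ s $ t * sqrt_vec r $ t"
proof -
  \<comment> \<open>Moving factors into the conditionals lets the sums against diagonal matrices
    collapse to one term.\<close>
  have *: "(if a = b then x else 0) * y = (if a = b then x * y else 0)"
    "y * (if a = b then x else 0) = (if a = b then y * x else 0)" for a b :: 'n and x y :: real
    by simp_all
  show ?thesis
    by (simp add: sandwich_def sqrt_diag_def diag_matrix_def sqrt_vec_def matrix_matrix_mult_def *)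
qed

lemma sandwich_scaleR: "sandwich r (k *\<^sub>R X) = k *\<^sub>R sandwich r X"
  by (simp add: vec_eq_iff sandwich_nth)

text \<open>A single sum over pairs, so that the coefficients of \<open>X\<close> can be treated as
  one family of weights.\<close>

lemma inner_sandwich:
  "w \<bullet> (sandwich r X *v v) =
     (\<Sum>(s, t)\<in>UNIV. sqrt_vec r $ s * w $ s * (sqrt_vec r $ t * v $ t) * X $ s $ t)"
  unfolding UNIV_Times_UNIV[symmetric] sum.cartesian_product[symmetric]
  by (simp add: inner_vec_def matrix_vector_mult_def sandwich_nth sum_distrib_left ac_simps)

lemma norm_sqrt_vec:
  assumes "\<forall>s. 0 < r $ s" and "(\<Sum>s\<in>UNIV. r $ s) = 1"
  shows "norm (sqrt_vec r) = 1"
  using assms by (simp add: norm_vec_def L2_set_def sqrt_vec_def less_imp_le)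

text \<open>Passing to entrywise absolute values keeps the norms of the maximisers and, by
  positivity of \<open>r\<close> and \<open>X\<close>, cannot lower the form.\<close>

lemma op_norm_sandwich_attained:
  fixes X :: "real ^ 'n ^ 'n"
  assumes r: "\<forall>s. 0 < r $ s" and X: "\<forall>s t. 0 < X $ s $ t"
  obtains w v where "norm w = 1" "norm v = 1" "\<forall>s. 0 \<le> w $ s" "\<forall>s. 0 \<le> v $ s"
    "op_norm (sandwich r X) = w \<bullet> (sandwich r X *v v)"
proof -
  obtain w v where wv: "norm w = 1" "norm v = 1" "op_norm (sandwich r X) = w \<bullet> (sandwich r X *v v)"
    by (rule op_norm_attained)
  let ?w = "\<chi> i. \<bar>w $ i\<bar>" and ?v = "\<chi> i. \<bar>v $ i\<bar>"
  have u: "0 \<le> sqrt_vec r $ s" for s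
    using r by (simp add: sqrt_vec_def less_imp_le)
  have "w $ s * v $ t \<le> \<bar>w $ s\<bar> * \<bar>v $ t\<bar>" for s t
    by (metis abs_ge_self abs_mult)
  then have "sqrt_vec r $ s * sqrt_vec r $ t * X $ s $ t * (w $ s * v $ t)
      \<le> sqrt_vec r $ s * sqrt_vec r $ t * X $ s $ t * (\<bar>w $ s\<bar> * \<bar>v $ t\<bar>)" for s t
    using u X by (intro mult_left_mono mult_nonneg_nonneg) (auto intro: less_imp_le)
  then have "w \<bullet> (sandwich r X *v v) \<le> ?w \<bullet> (sandwich r X *v ?v)"
    unfolding inner_sandwich by (intro sum_mono) (auto simp: ac_simps)
  moreover have "?w \<bullet> (sandwich r X *v ?v) \<le> op_norm (sandwich r X)"
    using wv by (intro inner_le_op_norm) (simp_all add: norm_abs_vec)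
  ultimately show thesis
    using that[of ?w ?v] wv by (simp add: norm_abs_vec)
qed

section \<open>The norm inequality and its equality case\<close>

lemma eq_of_inner_eq_1:
  fixes x y :: "'a :: real_inner"
  assumes "norm x = 1" "norm y = 1" "x \<bullet> y = 1"
  shows "x = y"
  using norm_cauchy_schwarz_eq[of x y] assms by simp

lemma op_norm_sandwich_power2_le:
  fixes X :: "real ^ 'n ^ 'n"
  assumes r: "\<forall>s. 0 < r $ s" "(\<Sum>s\<in>UNIV. r $ s) = 1" and X: "\<forall>s t. 0 < X $ s $ t"
  defines "Y \<equiv> \<chi> s t. (X $ s $ t)\<^sup>2"
  shows "(op_norm (sandwich r X))\<^sup>2 \<le> op_norm (sandwich r Y)"
    and "(op_norm (sandwich r X))\<^sup>2 = op_norm (sandwich r Y) \<Longrightarrow> X $ s $ t = op_norm (sandwich r X)"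
proof -
  obtain w v where wv: "norm w = 1" "norm v = 1" "\<forall>s. 0 \<le> w $ s" "\<forall>s. 0 \<le> v $ s"
    and att: "op_norm (sandwich r X) = w \<bullet> (sandwich r X *v v)"
    using op_norm_sandwich_attained[OF r(1) X] .
  let ?u = "sqrt_vec r"
  have nu: "norm ?u = 1"
    using r by (rule norm_sqrt_vec)
  have u: "0 < ?u $ s" for s
    using r by (simp add: sqrt_vec_def)
  define p where "p = (\<lambda>(s, t). ?u $ s * w $ s * (?u $ t * v $ t))"
  define a where "a = (\<lambda>(s, t). X $ s $ t)"
  define S where "S = op_norm (sandwich r X)"
  have p: "0 \<le> p z" for z
    using wv less_imp_le[OF u] by (auto simp: p_def split: prod.split intro!: mult_nonneg_nonneg)
  have S: "(\<Sum>z\<in>UNIV. p z * a z) = S"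
    unfolding S_def att inner_sandwich by (rule sum.cong) (auto simp: p_def a_def)
  have "(\<Sum>z\<in>UNIV. p z * (a z)\<^sup>2) = w \<bullet> (sandwich r Y *v v)"
    unfolding inner_sandwich by (rule sum.cong) (auto simp: p_def a_def Y_def)
  \<comment> \<open>The maximisers for \<open>X\<close> serve merely as test vectors for
    \<open>Y\<close>.\<close>
  then have Q: "(\<Sum>z\<in>UNIV. p z * (a z)\<^sup>2) \<le> op_norm (sandwich r Y)"
    using inner_le_op_norm[OF wv(1,2)] by simp
  have P: "(\<Sum>z\<in>UNIV. p z) = (?u \<bullet> w) * (?u \<bullet> v)"
    unfolding UNIV_Times_UNIV[symmetric] p_def sum.cartesian_product[symmetric]
    by (simp add: inner_vec_def sum_product)
  have uw: "?u \<bullet> w \<le> 1" "?u \<bullet> v \<le> 1" "0 \<le> ?u \<bullet> w" "0 \<le> ?u \<bullet> v"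
    using norm_cauchy_schwarz[of ?u w] norm_cauchy_schwarz[of ?u v] nu wv less_imp_le[OF u]
    by (auto simp: inner_vec_def intro!: sum_nonneg mult_nonneg_nonneg)
  then have P1: "(\<Sum>z\<in>UNIV. p z) \<le> 1"
    unfolding P by (simp add: mult_le_one)
  have "(\<Sum>z\<in>UNIV. p z * (a z - S)\<^sup>2)
      = (\<Sum>z\<in>UNIV. p z * (a z)\<^sup>2 - 2 * S * (p z * a z) + S\<^sup>2 * p z)"
    by (rule sum.cong) (auto simp: power2_eq_square algebra_simps)
  also have "\<dots> = (\<Sum>z\<in>UNIV. p z * (a z)\<^sup>2) - 2 * S * S + S\<^sup>2 * (\<Sum>z\<in>UNIV. p z)"
    by (simp only: sum.distrib sum_subtractf sum_distrib_left[symmetric] S)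
  \<comment> \<open>A variance identity for weights of mass at most 1: the second moment exceeds
    \<open>S\<^sup>2\<close> by a variance and a mass-defect term, both nonnegative, so equality of
    the norms kills both.\<close>
  finally have var: "(\<Sum>z\<in>UNIV. p z * (a z - S)\<^sup>2) + S\<^sup>2 * (1 - (\<Sum>z\<in>UNIV. p z)) + S\<^sup>2
      = (\<Sum>z\<in>UNIV. p z * (a z)\<^sup>2)"
    by (simp add: power2_eq_square algebra_simps)
  have V: "0 \<le> (\<Sum>z\<in>UNIV. p z * (a z - S)\<^sup>2)"
    using p by (intro sum_nonneg mult_nonneg_nonneg) auto
  have D: "0 \<le> S\<^sup>2 * (1 - (\<Sum>z\<in>UNIV. p z))"
    using P1 by simp
  show "(op_norm (sandwich r X))\<^sup>2 \<le> op_norm (sandwich r Y)"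
    using var V D Q unfolding S_def[symmetric] by linarith
  assume "(op_norm (sandwich r X))\<^sup>2 = op_norm (sandwich r Y)"
  then have V0: "(\<Sum>z\<in>UNIV. p z * (a z - S)\<^sup>2) = 0" and D0: "S\<^sup>2 * (1 - (\<Sum>z\<in>UNIV. p z)) = 0"
    using var V D Q unfolding S_def[symmetric] by linarith+
  \<comment> \<open>Positivity of \<open>S\<close> is needed to cancel \<open>S\<^sup>2\<close> in
    \<open>D0\<close> and conclude that the total mass is exactly 1.\<close>
  have "sandwich r X $ s $ t \<noteq> 0"
    using u[of s] u[of t] X by (simp add: sandwich_nth) (metis less_irrefl)
  then have "sandwich r X \<noteq> 0"
    by auto
  then have "0 < S"
    unfolding S_def by (rule op_norm_pos)
  with D0 have "(?u \<bullet> w) * (?u \<bullet> v) = 1"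
    unfolding P by simp
  \<comment> \<open>Both factors lie in the unit interval, so each is at least their product, which
    is 1.\<close>
  then have "?u \<bullet> w = 1" "?u \<bullet> v = 1"
    using uw mult_right_le_one_le[of "?u \<bullet> w" "?u \<bullet> v"] mult_left_le_one_le[of "?u \<bullet> v" "?u \<bullet> w"] by auto
  then have "w = ?u" "v = ?u"
    using eq_of_inner_eq_1 nu wv by metis+
  \<comment> \<open>The weight is now \<open>r $ s * r $ t\<close>, so the vanishing variance term
    forces \<open>a (s, t) = S\<close>.\<close>
  then have "0 < p (s, t)"
    using u by (simp add: p_def)
  moreover have "p (s, t) * (a (s, t) - S)\<^sup>2 = 0"
    using V0 p by (subst (asm) sum_nonneg_eq_0_iff) auto
  ultimately show "X $ s $ t = op_norm (sandwich r X)"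
    by (simp add: a_def S_def)
qed

text \<open>The matrix is \<open>c\<close> times the rank-one projection onto the unit vector
  \<open>sqrt_vec r\<close>, which attains the norm. This gives the converse half of the equality
  case.\<close>

lemma op_norm_sandwich_const:
  fixes r :: "real ^ 'n"
  assumes r: "\<forall>s. 0 < r $ s" "(\<Sum>s\<in>UNIV. r $ s) = 1" and c: "0 < c"
  shows "op_norm (sandwich r (\<chi> s t. c)) = c"
proof -
  let ?u = "sqrt_vec r" and ?X = "(\<chi> s t. c) :: real ^ 'n ^ 'n"
  have nu: "norm ?u = 1"
    using r by (rule norm_sqrt_vec)
  have form: "w \<bullet> (sandwich r ?X *v v) = c * ((?u \<bullet> w) * (?u \<bullet> v))" for w v
    unfolding inner_sandwich UNIV_Times_UNIV[symmetric] sum.cartesian_product[symmetric]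
    by (simp add: inner_vec_def sum_product sum_distrib_left ac_simps)
  obtain w v where wv: "norm w = 1" "norm v = 1" "\<forall>s. 0 \<le> w $ s" "\<forall>s. 0 \<le> v $ s"
    and att: "op_norm (sandwich r ?X) = w \<bullet> (sandwich r ?X *v v)"
    using op_norm_sandwich_attained[OF r(1), of ?X] c by auto
  have "\<bar>?u \<bullet> w\<bar> \<le> 1" "\<bar>?u \<bullet> v\<bar> \<le> 1"
    using Cauchy_Schwarz_ineq2[of ?u w] Cauchy_Schwarz_ineq2[of ?u v] nu wv by auto
  then have "\<bar>(?u \<bullet> w) * (?u \<bullet> v)\<bar> \<le> 1"
    unfolding abs_mult by (simp add: mult_le_one)
  then have "op_norm (sandwich r ?X) \<le> c"
    unfolding att form using c by simp
  moreover have "c \<le> op_norm (sandwich r ?X)"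
    using inner_le_op_norm[OF nu nu, of "sandwich r ?X"] nu unfolding form
    by (simp add: power2_norm_eq_inner[symmetric])
  ultimately show ?thesis
    by simp
qed

text \<open>The general inequality applies with \<open>X\<close> the entrywise inverse square root
  of \<open>\<Delta>\<close>, whose entrywise square is the entrywise inverse.\<close>

lemma noise_profile_bound:
  fixes r :: "real ^ 'n"
  assumes r: "\<forall>s. 0 < r $ s" "(\<Sum>s\<in>UNIV. r $ s) = 1" and \<Delta>: "noise_profile \<Delta>"
  defines "S \<equiv> op_norm (sandwich r (hadamard_inverse (hadamard_sqrt \<Delta>)))"
    and "T \<equiv> op_norm (sandwich r (hadamard_inverse \<Delta>))"
  shows "S\<^sup>2 \<le> T" "S\<^sup>2 = T \<longleftrightarrow> constant_profile \<Delta>"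
proof -
  let ?A = "hadamard_inverse (hadamard_sqrt \<Delta>)"
  have pos: "0 < \<Delta> $ s $ t" for s t
    using \<Delta> by (simp add: noise_profile_def)
  have A: "\<forall>s t. 0 < ?A $ s $ t"
    using pos by (simp add: hadamard_inverse_def hadamard_sqrt_def)
  have sq: "(\<chi> s t. (?A $ s $ t)\<^sup>2) = hadamard_inverse \<Delta>"
    using pos by (simp add: hadamard_inverse_def hadamard_sqrt_def vec_eq_iff power_divide less_imp_le)
  show "S\<^sup>2 \<le> T"
    using op_norm_sandwich_power2_le(1)[OF r A] unfolding sq S_def T_def .
  show "S\<^sup>2 = T \<longleftrightarrow> constant_profile \<Delta>"
  proof
    assume "S\<^sup>2 = T"
    then have "?A $ s $ t = S" for s t
      using op_norm_sandwich_power2_le(2)[OF r A] unfolding sq S_def T_def by blast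
    then have eq: "S = 1 / sqrt (\<Delta> $ s $ t)" for s t
      by (simp add: hadamard_inverse_def hadamard_sqrt_def)
    have "\<Delta> $ s $ t = (1 / S)\<^sup>2" for s t
      using eq[of s t] pos[of s t] by simp
    then show "constant_profile \<Delta>"
      unfolding constant_profile_def by blast
  next
    assume "constant_profile \<Delta>"
    then obtain c where c: "\<And>s t. \<Delta> $ s $ t = c"
      unfolding constant_profile_def by auto
    with pos have "0 < c"
      by metis
    moreover have "?A = (\<chi> s t. 1 / sqrt c)" "hadamard_inverse \<Delta> = (\<chi> s t. 1 / c)"
      by (simp_all add: hadamard_inverse_def hadamard_sqrt_def c)
    ultimately show "S\<^sup>2 = T"
      unfolding S_def T_def by (simp add: op_norm_sandwich_const[OF r] power_divide)
  qed
qed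

section \<open>Rescaling and nonconstant profiles, for the strict containment\<close>

lemma noise_profile_scaleR:
  assumes "noise_profile \<Delta>" "0 < k"
  shows "noise_profile (k *\<^sub>R \<Delta>)"
proof -
  have "hadamard_inverse (k *\<^sub>R \<Delta>) = (1 / k) *\<^sub>R hadamard_inverse \<Delta>"
    by (simp add: hadamard_inverse_def vec_eq_iff)
  then show ?thesis
    using assms
    by (simp add: noise_profile_def pos_semidef_def transpose_scalar scaleR_matrix_vector_assoc[symmetric])
qed

text \<open>The witness is the entrywise inverse of the identity plus the all-ones matrix.\<close>

lemma ex_nonconstant_noise_profile:
  assumes "2 \<le> CARD('n)"
  obtains \<Delta> :: "real ^ 'n ^ 'n" where "noise_profile \<Delta>" "\<not> constant_profile \<Delta>"
proof -
  define \<Delta> :: "real ^ 'n ^ 'n" where "\<Delta> = (\<chi> s t. if s = t then 1 / 2 else 1)"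
  have inv: "hadamard_inverse \<Delta> = mat 1 + (\<chi> s t. 1)"
    by (simp add: vec_eq_iff hadamard_inverse_def \<Delta>_def mat_def)
  have "v \<bullet> ((\<chi> s t. 1) *v v) = (\<Sum>s\<in>UNIV. v $ s)\<^sup>2" for v :: "real ^ 'n"
    by (simp add: inner_vec_def matrix_vector_mult_def power2_eq_square sum_distrib_right)
  then have "0 \<le> v \<bullet> (hadamard_inverse \<Delta> *v v)" for v
    unfolding inv by (simp add: matrix_vector_mult_add_rdistrib inner_add_right)
  then have "noise_profile \<Delta>"
    by (auto simp: noise_profile_def pos_semidef_def transpose_def vec_eq_iff hadamard_inverse_def \<Delta>_def)
  moreover obtain s t :: 'n where "s \<noteq> t"
    using assms by (metis card_le_Suc0_iff_eq finite not_less_eq_eq numeral_2_eq_2)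
  then have "\<Delta> $ s $ s \<noteq> \<Delta> $ s $ t"
    by (simp add: \<Delta>_def)
  then have "\<not> constant_profile \<Delta>"
    unfolding constant_profile_def by metis
  ultimately show thesis
    using that by blast
qed

theorem proposition2p18:
  fixes r :: "real ^ 'n"
  assumes "\<forall>s. 0 < r $ s" and "(\<Sum>s\<in>UNIV. r $ s) = 1"
  shows
    "(\<forall>\<Delta> :: real ^ 'n ^ 'n. noise_profile \<Delta> \<longrightarrow>
        (op_norm (sqrt_diag r ** hadamard_inverse (hadamard_sqrt \<Delta>) ** sqrt_diag r))\<^sup>2
          \<le> op_norm (sqrt_diag r ** hadamard_inverse \<Delta> ** sqrt_diag r) \<and>
        ((op_norm (sqrt_diag r ** hadamard_inverse (hadamard_sqrt \<Delta>) ** sqrt_diag r))\<^sup>2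
            = op_norm (sqrt_diag r ** hadamard_inverse \<Delta> ** sqrt_diag r)
          \<longleftrightarrow> constant_profile \<Delta>)) \<and>
     (\<forall>(M :: 'a measure) (x :: 'a \<Rightarrow> real ^ 'k) (P\<^sub>0 :: (real ^ 'k) measure).
        prob_space M \<longrightarrow> x \<in> M \<rightarrow>\<^sub>M borel \<longrightarrow> distr M borel x = P\<^sub>0 \<longrightarrow>
        compact (measure_support P\<^sub>0) \<longrightarrow> covariance_matrix M x \<noteq> 0 \<longrightarrow> 2 \<le> CARD('n) \<longrightarrow>
        {\<Delta> :: real ^ 'n ^ 'n. noise_profile \<Delta> \<and> \<not> constant_profile \<Delta> \<and>
           op_norm (sqrt_diag r ** hadamard_inverse (hadamard_sqrt \<Delta>) ** sqrt_diag r)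
             \<ge> 1 / op_norm (covariance_matrix M x)}
        \<subset> {\<Delta>. noise_profile \<Delta> \<and> \<not> constant_profile \<Delta> \<and>
           op_norm (sqrt_diag r ** hadamard_inverse \<Delta> ** sqrt_diag r)
             \<ge> 1 / (op_norm (covariance_matrix M x))\<^sup>2})"
proof (fold sandwich_def, intro conjI allI impI)
  fix \<Delta> :: "real ^ 'n ^ 'n"
  assume "noise_profile \<Delta>"
  note bound = noise_profile_bound[OF assms this]
  show "(op_norm (sandwich r (hadamard_inverse (hadamard_sqrt \<Delta>))))\<^sup>2
      \<le> op_norm (sandwich r (hadamard_inverse \<Delta>))"
    by (rule bound)
  show "(op_norm (sandwich r (hadamard_inverse (hadamard_sqrt \<Delta>))))\<^sup>2
      = op_norm (sandwich r (hadamard_inverse \<Delta>)) \<longleftrightarrow> constant_profile \<Delta>"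
    by (rule bound)
next
  fix M :: "'a measure" and x :: "'a \<Rightarrow> real ^ 'k"
  assume cov: "covariance_matrix M x \<noteq> 0" and card: "2 \<le> CARD('n)"
  define C where "C = op_norm (covariance_matrix M x)"
  define S where "S = (\<lambda>\<Delta>. op_norm (sandwich r (hadamard_inverse (hadamard_sqrt \<Delta>))))"
  define T where "T = (\<lambda>\<Delta>. op_norm (sandwich r (hadamard_inverse \<Delta>)))"
  have C: "0 < C"
    unfolding C_def using cov by (rule op_norm_pos)
  have bound: "(S \<Delta>)\<^sup>2 \<le> T \<Delta>" "(S \<Delta>)\<^sup>2 = T \<Delta> \<longleftrightarrow> constant_profile \<Delta>" if "noise_profile \<Delta>" for \<Delta>
    using noise_profile_bound[OF assms that] by (simp_all add: S_def T_def)
  obtain \<Delta>\<^sub>0 :: "real ^ 'n ^ 'n" where \<Delta>\<^sub>0: "noise_profile \<Delta>\<^sub>0" "\<not> constant_profile \<Delta>\<^sub>0"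
    using ex_nonconstant_noise_profile[OF card] .
  \<comment> \<open>For a nonconstant profile the inequality is strict, so \<open>T\<close> exceeds
    a square.\<close>
  have "0 < T \<Delta>\<^sub>0"
    using bound[OF \<Delta>\<^sub>0(1)] \<Delta>\<^sub>0(2) zero_le_power2[of "S \<Delta>\<^sub>0"] by linarith
  \<comment> \<open>Scaling a profile by \<open>k\<close> divides \<open>T\<close> by
    \<open>k\<close>; this choice puts \<open>T\<close> of the scaled profile exactly at the
    threshold \<open>1 / C\<^sup>2\<close>.\<close>
  define k where "k = C\<^sup>2 * T \<Delta>\<^sub>0"
  have k: "0 < k"
    unfolding k_def using C \<open>0 < T \<Delta>\<^sub>0\<close> by simp
  define \<Delta>\<^sub>1 where "\<Delta>\<^sub>1 = k *\<^sub>R \<Delta>\<^sub>0"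
  have \<Delta>\<^sub>1: "noise_profile \<Delta>\<^sub>1"
    unfolding \<Delta>\<^sub>1_def using \<Delta>\<^sub>0(1) k by (rule noise_profile_scaleR)
  have nc: "\<not> constant_profile \<Delta>\<^sub>1"
    using \<Delta>\<^sub>0(2) k unfolding constant_profile_def \<Delta>\<^sub>1_def
    by (metis less_irrefl mult_left_cancel real_scaleR_def vector_scaleR_component)
  have "hadamard_inverse \<Delta>\<^sub>1 = (1 / k) *\<^sub>R hadamard_inverse \<Delta>\<^sub>0"
    by (simp add: \<Delta>\<^sub>1_def hadamard_inverse_def vec_eq_iff)
  then have "T \<Delta>\<^sub>1 = T \<Delta>\<^sub>0 / k"
    using k by (simp add: T_def sandwich_scaleR op_norm_scaleR)
  then have T: "T \<Delta>\<^sub>1 = 1 / C\<^sup>2"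
    using \<open>0 < T \<Delta>\<^sub>0\<close> by (simp add: k_def)
  with bound[OF \<Delta>\<^sub>1] nc have "(S \<Delta>\<^sub>1)\<^sup>2 < (1 / C)\<^sup>2"
    by (simp add: power_divide)
  then have "S \<Delta>\<^sub>1 < 1 / C"
    by (rule power2_less_imp_less) (use C in simp)
  then have "\<Delta>\<^sub>1 \<in> {\<Delta>. noise_profile \<Delta> \<and> \<not> constant_profile \<Delta> \<and> T \<Delta> \<ge> 1 / C\<^sup>2}
      - {\<Delta>. noise_profile \<Delta> \<and> \<not> constant_profile \<Delta> \<and> S \<Delta> \<ge> 1 / C}"
    using \<Delta>\<^sub>1 nc T by simp
  \<comment> \<open>The inclusion itself: squaring preserves the bound because \<open>1 / C\<close>
    is positive, and \<open>T\<close> dominates the square of \<open>S\<close>.\<close>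
  moreover have "T \<Delta> \<ge> 1 / C\<^sup>2" if "noise_profile \<Delta>" "S \<Delta> \<ge> 1 / C" for \<Delta>
    using power_mono[OF that(2), of 2] bound(1)[OF that(1)] C by (simp add: power_divide)
  ultimately have "{\<Delta>. noise_profile \<Delta> \<and> \<not> constant_profile \<Delta> \<and> S \<Delta> \<ge> 1 / C}
      \<subset> {\<Delta>. noise_profile \<Delta> \<and> \<not> constant_profile \<Delta> \<and> T \<Delta> \<ge> 1 / C\<^sup>2}"
    by blast
  then show "{\<Delta> :: real ^ 'n ^ 'n. noise_profile \<Delta> \<and> \<not> constant_profile \<Delta> \<and>
        op_norm (sandwich r (hadamard_inverse (hadamard_sqrt \<Delta>)))
          \<ge> 1 / op_norm (covariance_matrix M x)}
      \<subset> {\<Delta>. noise_profile \<Delta> \<and> \<not> constant_profile \<Delta> \<and>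
        op_norm (sandwich r (hadamard_inverse \<Delta>))
          \<ge> 1 / (op_norm (covariance_matrix M x))\<^sup>2}"
    unfolding S_def T_def C_def .
qed

end
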